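(* The reduction relation $\Longrightarrow$ on extended nominal $C$-unification problems generated by the simplification rules (del), (f), (f$^C$), ([a]), (ab), (var), (inst$_1$), (inst$_2$) is terminating.
   Context: Fix disjoint countably infinite sets of atoms and of variables, and a signature $\Sigma$ of term-formers with arities, some binary ones designated commutative and written $\mathsf f^C$. Nominal terms: $t::=a\mid\pi\cdot X\mid\mathsf f(t_1,\ldots,t_n)\mid[a]t$ where $\pi$ is a finite permutation of atoms; the permutation action on terms is $\pi\cdot a=\pi(a)$, $\pi\cdot(\pi'\cdot X)=(\pi\circ\pi')\cdot X$, $\pi\cdot[a]t=[\pi(a)](\pi\cdot t)$, $\pi\cdot\mathsf f(\vec t)=\mathsf f(\pi\cdot\vec t)$; $\mathrm{var}(t)$ is the set of variables of $t$; $(a\ b)$ is a swapping. A nominal $C$-unification problem is $\mathsf{N}\bar c.Pr$ with $\bar c$ a finite list of names and $Pr$ a finite set of constraints $s\approx_C^? t$; an extended problem is a finite set of such problems, and a step of $\Longrightarrow$ replaces one problem of the set by its result(s) under one rule: (del) $\mathsf N\bar c.Pr\uplus\{t\approx^?_C t\}\Rightarrow\mathsf N\bar c.Pr$; (f) for non-commutative $\mathsf f$, $\mathsf N\bar c.Pr\uplus\{\mathsf f(t_1..t_n)\approx^?_C\mathsf f(t'_1..t'_n)\}\Rightarrow\mathsf N\bar c.Pr\cup\{t_i\approx^?_C t_i'\}_{i}$; (f$^C$) $\mathsf N\bar c.Pr\uplus\{\mathsf f^C(t_0,t_1)\approx^?_C\mathsf f^C(s_0,s_1)\}$ is replaced by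 the two problems $\mathsf N\bar c.Pr\cup\{t_0\approx^?_C s_0,t_1\approx^?_C s_1\}$ and $\mathsf N\bar c.Pr\cup\{t_0\approx^?_C s_1,t_1\approx^?_C s_0\}$; ([a]) $\mathsf N\bar c.Pr\uplus\{[a]t\approx^?_C[a]t'\}\Rightarrow\mathsf N\bar c.Pr\cup\{t\approx^?_C t'\}$; (ab) $\mathsf N\bar c.Pr\uplus\{[a]t\approx^?_C[b]t'\}\Rightarrow\mathsf N\bar c,c_1.Pr\cup\{(a\ c_1)\cdot t\approx^?_C(b\ c_1)\cdot t'\}$ with $c_1$ a new name; (var) $\mathsf N\bar c.Pr\uplus\{\pi\cdot X\approx^?_C\pi'\cdot X\}\Rightarrow\mathsf N\bar c.Pr\cup\{(\pi'^{-1}\circ\pi)\cdot X\approx^?_C X\}$ if $\pi'\ne\mathrm{id}$; (inst$_1$) $\mathsf N\bar c.Pr\uplus\{\pi\cdot X\approx^?_C t\}\Rightarrow\mathsf N\bar c.Pr[X\mapsto\pi^{-1}\cdot t]$ if $X\notin\mathrm{var}(t)$; (inst$_2$) $\mathsf N\bar c.Pr\uplus\{t\approx^?_C\pi\cdot X\}\Rightarrow\mathsf N\bar c.Pr[X\mapsto\pi^{-1}\cdot t]$ if $X\notin\mathrm{var}(t)$. (Substitutions apply homomorphically with $(\pi\cdot X)\sigma=\pi\cdot(X\sigma)$.) *)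

theory Defs
  imports
    Main
    "HOL-Library.Countable"
    "HOL-Library.Infinite_Typeclass"
    "HOL-Combinatorics.Perm"
begin

unbundle permutation_syntax

section \<open>Signatures and nominal terms\<close>

record 'f signature =
  formers :: "'f set"
  arity :: "'f \<Rightarrow> nat"
  comm :: "'f set"

definition is_signature :: "'f signature \<Rightarrow> bool" where
  "is_signature S \<longleftrightarrow> comm S \<subseteq> formers S \<and> (\<forall>f \<in> comm S. arity S f = 2)"

text \<open>Atoms, variables and term-formers are drawn from the types \<open>'a\<close>, \<open>'v\<close> and \<open>'f\<close>; \<open>'a perm\<close> is
  the type of finitely supported permutations, with \<open>1\<close> as identity and \<open>*\<close> as composition. The
  plain variable \<open>X\<close> is the suspension \<open>Susp 1 X\<close>.\<close>

datatype ('a, 'v, 'f) trm =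
    Atom 'a
  | Susp "'a perm" 'v
  | Fn 'f "('a, 'v, 'f) trm list"
  | Abst 'a "('a, 'v, 'f) trm"

primrec trm_over :: "'f signature \<Rightarrow> ('a, 'v, 'f) trm \<Rightarrow> bool" where
  "trm_over S (Atom a) \<longleftrightarrow> True"
| "trm_over S (Susp \<pi> X) \<longleftrightarrow> True"
| "trm_over S (Fn f ts) \<longleftrightarrow> f \<in> formers S \<and> length ts = arity S f \<and> list_all (trm_over S) ts"
| "trm_over S (Abst a t) \<longleftrightarrow> trm_over S t"

primrec vars :: "('a, 'v, 'f) trm \<Rightarrow> 'v set" where
  "vars (Atom a) = {}"
| "vars (Susp \<pi> X) = {X}"
| "vars (Fn f ts) = \<Union> (set (map vars ts))"
| "vars (Abst a t) = vars t"

text \<open>All atoms occurring syntactically in a term, including those moved by a suspended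
  permutation.\<close>

primrec atms :: "('a, 'v, 'f) trm \<Rightarrow> 'a set" where
  "atms (Atom a) = {a}"
| "atms (Susp \<pi> X) = affected \<pi>"
| "atms (Fn f ts) = \<Union> (set (map atms ts))"
| "atms (Abst a t) = insert a (atms t)"

primrec act :: "'a perm \<Rightarrow> ('a, 'v, 'f) trm \<Rightarrow> ('a, 'v, 'f) trm" (infixr \<open>\<bullet>\<close> 75) where
  "\<pi> \<bullet> Atom a = Atom (\<pi> \<langle>$\<rangle> a)"
| "\<pi> \<bullet> Susp \<pi>' X = Susp (\<pi> * \<pi>') X"
| "\<pi> \<bullet> Fn f ts = Fn f (map (act \<pi>) ts)"
| "\<pi> \<bullet> Abst a t = Abst (\<pi> \<langle>$\<rangle> a) (\<pi> \<bullet> t)"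

primrec subst :: "('v \<Rightarrow> ('a, 'v, 'f) trm) \<Rightarrow> ('a, 'v, 'f) trm \<Rightarrow> ('a, 'v, 'f) trm" where
  "subst \<sigma> (Atom a) = Atom a"
| "subst \<sigma> (Susp \<pi> X) = \<pi> \<bullet> \<sigma> X"
| "subst \<sigma> (Fn f ts) = Fn f (map (subst \<sigma>) ts)"
| "subst \<sigma> (Abst a t) = Abst a (subst \<sigma> t)"

definition single :: "'v \<Rightarrow> ('a, 'v, 'f) trm \<Rightarrow> 'v \<Rightarrow> ('a, 'v, 'f) trm" where
  "single X t = (Susp 1)(X := t)"

section \<open>Unification problems\<close>

datatype ('a, 'v, 'f) constr = Constr "('a, 'v, 'f) trm" "('a, 'v, 'f) trm" (infix \<open>\<approx>?\<close> 51)

datatype ('a, 'v, 'f) problem = New "'a list" "('a, 'v, 'f) constr set"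

primrec constr_over :: "'f signature \<Rightarrow> ('a, 'v, 'f) constr \<Rightarrow> bool" where
  "constr_over S (s \<approx>? t) \<longleftrightarrow> trm_over S s \<and> trm_over S t"

primrec is_problem :: "'f signature \<Rightarrow> ('a, 'v, 'f) problem \<Rightarrow> bool" where
  "is_problem S (New cs Pr) \<longleftrightarrow> finite Pr \<and> (\<forall>e \<in> Pr. constr_over S e)"

definition is_ext_problem :: "'f signature \<Rightarrow> ('a, 'v, 'f) problem set \<Rightarrow> bool" where
  "is_ext_problem S E \<longleftrightarrow> finite E \<and> (\<forall>P \<in> E. is_problem S P)"

primrec constr_atms :: "('a, 'v, 'f) constr \<Rightarrow> 'a set" where
  "constr_atms (s \<approx>? t) = atms s \<union> atms t"

primrec problem_atms :: "('a, 'v, 'f) problem \<Rightarrow> 'a set" where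
  "problem_atms (New cs Pr) = set cs \<union> \<Union> (constr_atms ` Pr)"

primrec constr_subst ::
  "('v \<Rightarrow> ('a, 'v, 'f) trm) \<Rightarrow> ('a, 'v, 'f) constr \<Rightarrow> ('a, 'v, 'f) constr" where
  "constr_subst \<sigma> (s \<approx>? t) = subst \<sigma> s \<approx>? subst \<sigma> t"

section \<open>Simplification\<close>

text \<open>A rule turns a problem into the set of its results, which has two members for a commutative
  term-former and one otherwise. The disjoint union of \<open>Pr\<close> with a singleton is an \<open>insert\<close> whose
  element is not in \<open>Pr\<close>.\<close>

inductive simp_rule ::
  "'f signature \<Rightarrow> ('a, 'v, 'f) problem \<Rightarrow> ('a, 'v, 'f) problem set \<Rightarrow> bool" for S where
  del:
    "(t \<approx>? t) \<notin> Pr \<Longrightarrow>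
     simp_rule S (New cs (insert (t \<approx>? t) Pr)) {New cs Pr}"
| fn:
    "f \<notin> comm S \<Longrightarrow> length ts = length ts' \<Longrightarrow> (Fn f ts \<approx>? Fn f ts') \<notin> Pr \<Longrightarrow>
     simp_rule S (New cs (insert (Fn f ts \<approx>? Fn f ts') Pr))
       {New cs (Pr \<union> {ts ! i \<approx>? ts' ! i | i. i < length ts})}"
| fn_comm:
    "f \<in> comm S \<Longrightarrow> (Fn f [t0, t1] \<approx>? Fn f [s0, s1]) \<notin> Pr \<Longrightarrow>
     simp_rule S (New cs (insert (Fn f [t0, t1] \<approx>? Fn f [s0, s1]) Pr))
       {New cs (Pr \<union> {t0 \<approx>? s0, t1 \<approx>? s1}), New cs (Pr \<union> {t0 \<approx>? s1, t1 \<approx>? s0})}"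
| abs_same:
    "(Abst a t \<approx>? Abst a t') \<notin> Pr \<Longrightarrow>
     simp_rule S (New cs (insert (Abst a t \<approx>? Abst a t') Pr))
       {New cs (Pr \<union> {t \<approx>? t'})}"
| abs_diff:
    "(Abst a t \<approx>? Abst b t') \<notin> Pr \<Longrightarrow>
     c \<notin> problem_atms (New cs (insert (Abst a t \<approx>? Abst b t') Pr)) \<Longrightarrow>
     simp_rule S (New cs (insert (Abst a t \<approx>? Abst b t') Pr))
       {New (cs @ [c]) (Pr \<union> {\<langle>a \<leftrightarrow> c\<rangle> \<bullet> t \<approx>? \<langle>b \<leftrightarrow> c\<rangle> \<bullet> t'})}"
| var:
    "\<pi>' \<noteq> 1 \<Longrightarrow> (Susp \<pi> X \<approx>? Susp \<pi>' X) \<notin> Pr \<Longrightarrow>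
     simp_rule S (New cs (insert (Susp \<pi> X \<approx>? Susp \<pi>' X) Pr))
       {New cs (Pr \<union> {Susp (inverse \<pi>' * \<pi>) X \<approx>? Susp 1 X})}"
| inst1:
    "X \<notin> vars t \<Longrightarrow> (Susp \<pi> X \<approx>? t) \<notin> Pr \<Longrightarrow>
     simp_rule S (New cs (insert (Susp \<pi> X \<approx>? t) Pr))
       {New cs (constr_subst (single X (inverse \<pi> \<bullet> t)) ` Pr)}"
| inst2:
    "X \<notin> vars t \<Longrightarrow> (t \<approx>? Susp \<pi> X) \<notin> Pr \<Longrightarrow>
     simp_rule S (New cs (insert (t \<approx>? Susp \<pi> X) Pr))
       {New cs (constr_subst (single X (inverse \<pi> \<bullet> t)) ` Pr)}"

inductive ext_step ::
  "'f signature \<Rightarrow> ('a, 'v, 'f) problem set \<Rightarrow> ('a, 'v, 'f) problem set \<Rightarrow> bool" for S where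
  "is_ext_problem S E \<Longrightarrow> P \<in> E \<Longrightarrow> simp_rule S P Qs \<Longrightarrow> ext_step S E ((E - {P}) \<union> Qs)"

definition terminating :: "('b \<Rightarrow> 'b \<Rightarrow> bool) \<Rightarrow> bool" where
  "terminating R \<longleftrightarrow> \<not> (\<exists>x :: nat \<Rightarrow> 'b. \<forall>i. R (x i) (x (Suc i)))"

text \<open>The step relation is a relation on extended problems over \<open>S\<close>: targets stay in the carrier.\<close>

lemma trm_over_act [simp]: "trm_over S (\<pi> \<bullet> t) = trm_over S t"
  by (induction t) (auto simp: list_all_iff)

lemma trm_over_subst:
  assumes "\<And>X. trm_over S (\<sigma> X)" and "trm_over S t"
  shows "trm_over S (subst \<sigma> t)"
  using assms(2) by (induction t) (auto simp: list_all_iff assms(1))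

lemma constr_over_single:
  assumes "trm_over S t" and "constr_over S e"
  shows "constr_over S (constr_subst (single X t) e)"
proof -
  have "trm_over S (single X t Y)" for Y
    using assms(1) by (simp add: single_def)
  then show ?thesis
    using assms(2) by (cases e) (simp add: trm_over_subst)
qed

lemma simp_rule_is_problem:
  assumes "simp_rule S P Qs" and "is_problem S P"
  shows "finite Qs" and "Q \<in> Qs \<Longrightarrow> is_problem S Q"
proof -
  show "finite Qs"
    using assms(1) by cases auto
  show "is_problem S Q" if "Q \<in> Qs"
    using assms(1)
  proof cases
    case (fn f ts ts' Pr cs)
    then show ?thesis
      using assms(2) that by (auto simp: list_all_length)
  qed (use assms(2) that in \<open>auto simp: constr_over_single\<close>)
qed

lemma ext_step_is_ext_problem:
  assumes "ext_step S E E'"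
  shows "is_ext_problem S E" and "is_ext_problem S E'"
  using assms by (auto elim!: ext_step.cases simp: is_ext_problem_def dest: simp_rule_is_problem)

end

theory Submission
  imports Defs "HOL-Library.Multiset"
begin

text \<open>Every rule decreases, for each of its results, the lexicographic pair consisting of the number
  of variables and the total weight of the constraints: an instantiation eliminates its variable, and
  the other rules introduce no variable and replace a constraint by a collection of constraints of
  smaller total weight. A step on an extended problem therefore replaces a problem by finitely many
  smaller ones, which is a decrease in the multiset order.\<close>

primrec constr_vars :: "('a, 'v, 'f) constr \<Rightarrow> 'v set" where
  "constr_vars (s \<approx>? t) = vars s \<union> vars t"

primrec problem_vars :: "('a, 'v, 'f) problem \<Rightarrow> 'v set" where
  "problem_vars (New cs Pr) = \<Union> (constr_vars ` Pr)"

text \<open>Marks the right-hand sides that the rule (var) has yet to normalise.\<close>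

primrec nonid_susp :: "('a, 'v, 'f) trm \<Rightarrow> bool" where
  "nonid_susp (Atom a) = False"
| "nonid_susp (Susp \<pi> X) = (\<pi> \<noteq> 1)"
| "nonid_susp (Fn f ts) = False"
| "nonid_susp (Abst a t) = False"

text \<open>The function \<open>size\<close> vanishes on atoms and suspensions, and counts one for each argument
  of a term-former in addition to the size of the argument; this pays for the summand 1 and the
  summand for suspensions, which is what makes the rule for two suspensions of a variable
  decreasing.\<close>

primrec weight :: "('a, 'v, 'f) constr \<Rightarrow> nat" where
  "weight (s \<approx>? t) = size s + size t + 1 + of_bool (nonid_susp t)"

primrec problem_weight :: "('a, 'v, 'f) problem \<Rightarrow> nat" where
  "problem_weight (New cs Pr) = sum weight Pr"

definition problem_order :: "('a, 'v, 'f) problem rel" where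
  "problem_order = (\<lambda>P. card (problem_vars P)) <*mlex*> measure problem_weight"

lemma wf_problem_order: "wf problem_order"
  by (simp add: problem_order_def wf_mlex)

lemma size_act [simp]: "size (\<pi> \<bullet> t) = size t"
  by (induction t) (simp_all add: size_list_conv_sum_list cong: map_cong)

lemma vars_act [simp]: "vars (\<pi> \<bullet> t) = vars t"
  by (induction t) auto

lemma finite_vars [simp]: "finite (vars t)"
  by (induction t) auto

lemma finite_constr_vars [simp]: "finite (constr_vars e)"
  by (cases e) simp

lemma finite_problem_vars: "is_problem S P \<Longrightarrow> finite (problem_vars P)"
  by (cases P) simp

lemma vars_subst: "vars (subst \<sigma> t) = (\<Union>X \<in> vars t. vars (\<sigma> X))"
  by (induction t) auto

lemma constr_vars_subst: "constr_vars (constr_subst \<sigma> e) = (\<Union>X \<in> constr_vars e. vars (\<sigma> X))"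
  by (cases e) (simp add: vars_subst)

lemma constr_vars_single: "constr_vars (constr_subst (single X t) e) \<subseteq> (constr_vars e - {X}) \<union> vars t"
  by (auto simp: constr_vars_subst single_def split: if_splits)

lemma problem_orderI_weight:
  assumes "is_problem S P" and "problem_vars Q \<subseteq> problem_vars P"
    and "problem_weight Q < problem_weight P"
  shows "(Q, P) \<in> problem_order"
proof -
  have "card (problem_vars Q) \<le> card (problem_vars P)"
    using assms(1,2) by (simp add: card_mono finite_problem_vars)
  then show ?thesis
    using assms(3) by (auto simp: problem_order_def mlex_iff)
qed

text \<open>Serves every rule except the instantiations: \<open>I\<close> holds the constraints
  replacing \<open>e\<close>. Names do not enter the measure, so \<open>cs'\<close> is
  arbitrary.\<close>

lemma problem_order_decompose:
  assumes "is_problem S (New cs (insert e Pr))" and "e \<notin> Pr" and "finite I"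
    and "sum weight I < weight e" and "\<Union> (constr_vars ` I) \<subseteq> constr_vars e"
  shows "(New cs' (Pr \<union> I), New cs (insert e Pr)) \<in> problem_order"
proof (rule problem_orderI_weight[OF assms(1)])
  show "problem_vars (New cs' (Pr \<union> I)) \<subseteq> problem_vars (New cs (insert e Pr))"
    using assms(5) by auto
  \<comment> \<open>Only an inequality, since \<open>I\<close> may overlap
    \<open>Pr\<close>.\<close>
  have "sum weight (Pr \<union> I) \<le> sum weight Pr + sum weight I"
    using assms(1,3) by (simp add: sum_Un_nat)
  then show "problem_weight (New cs' (Pr \<union> I)) < problem_weight (New cs (insert e Pr))"
    using assms(1,2,4) by simp
qed

text \<open>The weight may grow here, but \<open>X\<close> disappears and the variables of
  \<open>t\<close> already occur in \<open>e\<close>. The condition on \<open>constr_vars e\<close>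
  is symmetric in the two sides and so fits both instantiation rules.\<close>

lemma problem_order_inst:
  assumes "is_problem S (New cs (insert e Pr))" and "constr_vars e = insert X (vars t)"
    and "X \<notin> vars t"
  shows "(New cs (constr_subst (single X (\<pi> \<bullet> t)) ` Pr), New cs (insert e Pr)) \<in> problem_order"
    (is "(?Q, ?P) \<in> _")
proof -
  have "problem_vars ?Q \<subseteq> problem_vars ?P - {X}"
    using constr_vars_single[of X "\<pi> \<bullet> t"] assms(2,3) by fastforce
  moreover have "X \<in> problem_vars ?P"
    using assms(2) by simp
  ultimately have "problem_vars ?Q \<subset> problem_vars ?P"
    by blast
  then have "card (problem_vars ?Q) < card (problem_vars ?P)"
    by (rule psubset_card_mono[OF finite_problem_vars[OF assms(1)]])
  then show ?thesis
    by (simp add: problem_order_def mlex_less)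
qed

text \<open>Strict when the two constraints coincide, since a set counts them once.\<close>

lemma sum_weight_pair_le: "sum weight {e, e'} \<le> weight e + weight e'"
  by (cases "e = e'") simp_all

text \<open>An argument pair weighs at most its two sizes plus 2, and \<open>size_list\<close>
  provides exactly one extra unit per argument on each side. The outer term-formers make the bound
  strict, even without arguments.\<close>

lemma sum_weight_args:
  assumes "length ts = length ts'"
  shows "sum weight {ts ! i \<approx>? ts' ! i | i. i < length ts} < weight (Fn f ts \<approx>? Fn f ts')"
proof -
  have "{ts ! i \<approx>? ts' ! i | i. i < length ts} = (\<lambda>i. ts ! i \<approx>? ts' ! i) ` {..<length ts}"
    by auto
  then have "sum weight {ts ! i \<approx>? ts' ! i | i. i < length ts}
      \<le> (\<Sum>i<length ts. weight (ts ! i \<approx>? ts' ! i))"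
    using sum_image_le[of "{..<length ts}" weight "\<lambda>i. ts ! i \<approx>? ts' ! i"] by (simp add: comp_def)
  also have "\<dots> \<le> (\<Sum>i<length ts. Suc (size (ts ! i)) + Suc (size (ts' ! i)))"
    by (rule sum_mono) simp
  also have "\<dots> = size_list size ts + size_list size ts'"
    using assms by (simp add: sum.distrib size_list_conv_sum_list sum_list_sum_nth
        atLeast0LessThan sum_Suc)
  finally show ?thesis
    by simp
qed

lemma simp_rule_decreases:
  assumes "simp_rule S P Qs" and "is_problem S P" and "Q \<in> Qs"
  shows "(Q, P) \<in> problem_order"
  using assms(1)
proof cases
  case (del t Pr cs)
  then show ?thesis
    using problem_order_decompose[of S cs "t \<approx>? t" Pr "{}" cs] assms(2,3) by simp
next
  case (fn f ts ts' Pr cs)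
  let ?I = "{ts ! i \<approx>? ts' ! i | i. i < length ts}"
  have "\<Union> (constr_vars ` ?I) \<subseteq> constr_vars (Fn f ts \<approx>? Fn f ts')"
    using fn(4) by (auto dest: nth_mem)
  then show ?thesis
    using problem_order_decompose[of S cs "Fn f ts \<approx>? Fn f ts'" Pr ?I cs]
      sum_weight_args[OF fn(4), of f] fn assms(2,3) by simp
next
  case (fn_comm f t0 t1 s0 s1 Pr cs)
  let ?e = "Fn f [t0, t1] \<approx>? Fn f [s0, s1]"
  consider "Q = New cs (Pr \<union> {t0 \<approx>? s0, t1 \<approx>? s1})" | "Q = New cs (Pr \<union> {t0 \<approx>? s1, t1 \<approx>? s0})"
    using fn_comm(2) assms(3) by blast
  then show ?thesis
  proof cases
    case 1
    have "sum weight {t0 \<approx>? s0, t1 \<approx>? s1} < weight ?e"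
      by (rule le_less_trans[OF sum_weight_pair_le]) simp
    then show ?thesis
      unfolding 1 fn_comm(1) using fn_comm assms(2)
      by (intro problem_order_decompose[of S]) auto
  next
    case 2
    have "sum weight {t0 \<approx>? s1, t1 \<approx>? s0} < weight ?e"
      by (rule le_less_trans[OF sum_weight_pair_le]) simp
    then show ?thesis
      unfolding 2 fn_comm(1) using fn_comm assms(2)
      by (intro problem_order_decompose[of S]) auto
  qed
next
  case (abs_same a t t' Pr cs)
  then show ?thesis
    using problem_order_decompose[of S cs "Abst a t \<approx>? Abst a t'" Pr "{t \<approx>? t'}" cs] assms(2,3)
    by simp
next
  case (abs_diff a t b t' Pr c cs)
  then show ?thesis
    \<comment> \<open>Swapping preserves sizes and variables; the two lost abstractions outweigh a
      possible new summand for a suspension.\<close>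
    using problem_order_decompose[of S cs "Abst a t \<approx>? Abst b t'" Pr
        "{\<langle>a \<leftrightarrow> c\<rangle> \<bullet> t \<approx>? \<langle>b \<leftrightarrow> c\<rangle> \<bullet> t'}" "cs @ [c]"] assms(2,3)
    by simp
next
  case (var \<pi>' \<pi> X Pr cs)
  then show ?thesis
    \<comment> \<open>Both sizes are 0, so the weight drops from 2 to 1.\<close>
    using problem_order_decompose[of S cs "Susp \<pi> X \<approx>? Susp \<pi>' X" Pr
        "{Susp (inverse \<pi>' * \<pi>) X \<approx>? Susp 1 X}" cs] assms(2,3)
    by simp
next
  case (inst1 X t \<pi> Pr cs)
  then show ?thesis
    using problem_order_inst[of S cs "Susp \<pi> X \<approx>? t" Pr X t] assms(2,3) by simp
next
  case (inst2 X t \<pi> Pr cs)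
  then show ?thesis
    using problem_order_inst[of S cs "t \<approx>? Susp \<pi> X" Pr X t] assms(2,3) by simp
qed

lemma ext_step_decreases:
  assumes "ext_step S E E'"
  shows "(mset_set E', mset_set E) \<in> mult1 problem_order"
  using assms
proof cases
  case (1 P Qs)
  \<comment> \<open>Results already present elsewhere in \<open>E\<close> are absorbed by the union,
    so only the others enter the multiset.\<close>
  let ?new = "Qs - (E - {P})"
  have P: "is_problem S P" and E: "finite E" and Qs: "finite Qs"
    using 1 simp_rule_is_problem(1) by (auto simp: is_ext_problem_def)
  have "mset_set E = add_mset P (mset_set (E - {P}))"
    using E 1(3) by (simp add: mset_set.remove)
  moreover have "mset_set E' = mset_set (E - {P}) + mset_set ?new"
  proof -
    have "E' = (E - {P}) \<union> ?new"
      using 1(1) by blast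
    then show ?thesis
      using E Qs by (metis Diff_disjoint finite_Diff mset_set_Union)
  qed
  moreover have "(Q, P) \<in> problem_order" if "Q \<in># mset_set ?new" for Q
    using that Qs simp_rule_decreases[OF 1(4) P] by simp
  ultimately show ?thesis
    by (auto simp: mult1_def)
qed

theorem theorem3:
  fixes S :: "'f signature"
  assumes "is_signature S"
  shows "terminating
    (ext_step S :: ('a::{countable,infinite}, 'v::{countable,infinite}, 'f) problem set \<Rightarrow>
      ('a, 'v, 'f) problem set \<Rightarrow> bool)"
  unfolding terminating_def
proof
  assume "\<exists>E :: nat \<Rightarrow> ('a, 'v, 'f) problem set. \<forall>i. ext_step S (E i) (E (Suc i))"
  then obtain E :: "nat \<Rightarrow> ('a, 'v, 'f) problem set" where "\<And>i. ext_step S (E i) (E (Suc i))"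
    by blast
  then have "\<forall>i. (mset_set (E (Suc i)), mset_set (E i)) \<in> mult1 problem_order"
    by (blast intro: ext_step_decreases)
  then have "\<exists>M. \<forall>i. (M (Suc i), M i) \<in> mult1 (problem_order :: ('a, 'v, 'f) problem rel)"
    by (rule exI[of _ "\<lambda>i. mset_set (E i)"])
  then show False
    \<comment> \<open>Well-foundedness passes from \<open>problem_order\<close> to
      \<open>mult1\<close>, which excludes the descending chain of multisets.\<close>
    using wf_mult1[OF wf_problem_order] unfolding wf_iff_no_infinite_down_chain by blast
qed

end
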